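(* Let $f\colon \mathbb{R}^n \to \mathbb{R}\cup \{+\infty\}$ be proper, lower semicontinuous, and $\rho$-weakly convex for some $\rho\geq 0$. Assume that $\operatorname{dom} f$ has nonempty interior. Fix $x\in \mathbb{R}^n$ and $0<\lambda <1/\rho$, and set $\mu:=\frac{1}{\lambda}-\rho>0$. Then, for every $\delta>0$, $$ \Vert m_{\delta}(x)-\operatorname{prox}_{\lambda f}(x)\Vert \leq \sqrt{\frac{n\delta}{\mu}}. $$
   Context: $\mathbb{R}^n$ carries its Euclidean inner product and norm $\|\cdot\|$. Conventions: $1/0=+\infty$ and $\exp(-\infty)=0$. For $f\colon\mathbb{R}^n\to\mathbb{R}\cup\{+\infty\}$, $\operatorname{dom} f:=\{y: f(y)<+\infty\}$, and $f$ is proper if $\operatorname{dom} f\neq\emptyset$. The function $f$ is $\rho$-weakly convex ($\rho\ge 0$) if $f+\frac{\rho}{2}\|\cdot\|^2$ is convex. For $f$ proper, lower semicontinuous and $\rho$-weakly convex and $0<\lambda<1/\rho$, $\operatorname{prox}_{\lambda f}(x)$ denotes the unique minimizer over $y\in\mathbb{R}^n$ of $y\mapsto f(y)+\frac{1}{2\lambda}\|x-y\|^2$. For $\delta>0$, $$ m_{\delta}(x):=\frac{\mathbb{E}_{y\sim \mathcal{N}(x,\delta \lambda I)}\bigl[y\, \exp(-f(y)/\delta)\bigr]}{\mathbb{E}_{y\sim \mathcal{N}(x,\delta \lambda I)}\bigl[\exp(-f(y)/\delta)\bigr]} =\frac{\int_{\mathbb{R}^n} y\,e^{-g(y)/\delta}\,dy}{\int_{\mathbb{R}^n}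 e^{-g(y)/\delta}\,dy},\qquad g(y):=f(y)+\frac{1}{2\lambda}\|x-y\|^2, $$ where $\mathcal{N}(x,\delta\lambda I)$ is the Gaussian distribution on $\mathbb{R}^n$ with mean $x$ and covariance $\delta\lambda I$. *)

theory Defs
  imports "HOL-Probability.Probability"
begin

text \<open>
  Functions into \<open>\<real> \<union> {+\<infinity>}\<close> are modelled as \<^typ>\<open>ereal\<close>-valued functions; that the value
  \<open>-\<infinity>\<close> is not attained is a separate hypothesis wherever it is needed.
\<close>

definition effective_domain :: "('a \<Rightarrow> ereal) \<Rightarrow> 'a set" where
  "effective_domain f = {y. f y < \<infinity>}"

definition proper_fun :: "('a \<Rightarrow> ereal) \<Rightarrow> bool" where
  "proper_fun f \<longleftrightarrow> effective_domain f \<noteq> {}"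

definition lower_semicontinuous :: "('a::topological_space \<Rightarrow> ereal) \<Rightarrow> bool" where
  "lower_semicontinuous f \<longleftrightarrow> (\<forall>x. f x \<le> Liminf (at x) f)"

text \<open>
  The analogue of \<^const>\<open>convex_on\<close> on the whole space for functions that avoid \<open>-\<infinity>\<close>.  The
  endpoints are harmless because \<open>0 * \<infinity> = 0\<close> in \<^typ>\<open>ereal\<close>.
\<close>

definition convex_ereal :: "('a::real_vector \<Rightarrow> ereal) \<Rightarrow> bool" where
  "convex_ereal f \<longleftrightarrow>
    (\<forall>x y. \<forall>u\<ge>0. \<forall>v\<ge>0. u + v = 1 \<longrightarrow>
      f (u *\<^sub>R x + v *\<^sub>R y) \<le> ereal u * f x + ereal v * f y)"

definition weakly_convex :: "real \<Rightarrow> ('a::real_normed_vector \<Rightarrow> ereal) \<Rightarrow> bool" where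
  "weakly_convex \<rho> f \<longleftrightarrow> convex_ereal (\<lambda>y. f y + ereal (\<rho> / 2 * (norm y)\<^sup>2))"

text \<open>The definite description is meaningful exactly when the minimizer is unique.\<close>

definition prox :: "real \<Rightarrow> ('a::real_normed_vector \<Rightarrow> ereal) \<Rightarrow> 'a \<Rightarrow> 'a" where
  "prox lam f x =
    (THE p. is_arg_min (\<lambda>y. f y + ereal (1 / (2 * lam) * (norm (x - y))\<^sup>2)) (\<lambda>_. True) p)"

text \<open>
  The exponential with \<open>exp (-\<infinity>) = 0\<close>.  The value at \<open>+\<infinity>\<close> is a dummy: below, the argument is
  \<open>- f y / \<delta>\<close> with \<open>f y \<noteq> -\<infinity>\<close>.
\<close>

definition exp_ereal :: "ereal \<Rightarrow> real" where
  "exp_ereal a = (if \<bar>a\<bar> = \<infinity> then 0 else exp (real_of_ereal a))"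

text \<open>
  The Gaussian distribution with mean \<open>x\<close> and covariance \<open>s I\<close>: the coordinates are independent
  with variance \<open>s\<close>.  The second argument of \<^const>\<open>normal_density\<close> is the standard deviation.
\<close>

definition isotropic_gaussian :: "real ^ 'n \<Rightarrow> real \<Rightarrow> (real ^ 'n) measure" where
  "isotropic_gaussian x s =
    density lborel (\<lambda>y. ennreal (\<Prod>i\<in>UNIV. normal_density (x $ i) (sqrt s) (y $ i)))"

definition gibbs_mean :: "real \<Rightarrow> (real ^ 'n \<Rightarrow> ereal) \<Rightarrow> real \<Rightarrow> real ^ 'n \<Rightarrow> real ^ 'n" where
  "gibbs_mean lam f \<delta> x =
    (LINT y|isotropic_gaussian x (\<delta> * lam). exp_ereal (- f y / ereal \<delta>) *\<^sub>R y) /\<^sub>R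
    (LINT y|isotropic_gaussian x (\<delta> * lam). exp_ereal (- f y / ereal \<delta>))"

end

theory Submission
  imports Defs
begin

text \<open>
  The minimizer \<open>p\<close> of the \<open>\<mu>\<close>-strongly convex \<open>g\<close> satisfies
  \<open>g (p + t *\<^sub>R z) \<le> g (p + z) - \<mu> / 2 * (1 - t\<^sup>2) * (norm z)\<^sup>2\<close> for \<open>0 \<le> t \<le> 1\<close>.
  Integrating \<open>exp (- g / \<delta>)\<close> over both sides and letting \<open>t \<rightarrow> 1\<close> bounds the second moment of the
  Gibbs measure about \<open>p\<close> by \<open>n * \<delta> / \<mu>\<close>, which dominates the squared distance from \<open>p\<close> to its mean.
\<close>

section \<open>Integration: affine substitutions, Gaussian integrability, second moments and
  barycentres\<close>

lemma integrable_lborel_affine: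
  fixes f :: "'a::euclidean_space \<Rightarrow> real"
  assumes "c \<noteq> 0" and f: "integrable lborel f"
  shows "integrable lborel (\<lambda>x. f (t + c *\<^sub>R x))"
proof -
  have [measurable]: "f \<in> borel_measurable borel"
    using borel_measurable_integrable[OF f] by simp
  have "integrable (density (distr lborel borel (\<lambda>x. t + c *\<^sub>R x)) (\<lambda>_. \<bar>c\<bar>^DIM('a))) f"
    using f lborel_affine[OF \<open>c \<noteq> 0\<close>, of t] by simp
  then have "integrable lborel (\<lambda>x. \<bar>c\<bar>^DIM('a) * f (t + c *\<^sub>R x))"
    by (simp add: integrable_density integrable_distr_eq)
  then show ?thesis
    using \<open>c \<noteq> 0\<close> by simp
qed

lemma integral_lborel_affine:
  fixes f :: "'a::euclidean_space \<Rightarrow> real"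
  assumes "c \<noteq> 0" and [measurable]: "f \<in> borel_measurable borel"
  shows "(LINT x|lborel. f x) = \<bar>c\<bar>^DIM('a) * (LINT x|lborel. f (t + c *\<^sub>R x))"
proof -
  have "(LINT x|lborel. f x)
      = (LINT x|density (distr lborel borel (\<lambda>x. t + c *\<^sub>R x)) (\<lambda>_. \<bar>c\<bar>^DIM('a)). f x)"
    using lborel_affine[OF \<open>c \<noteq> 0\<close>, of t] by simp
  also have "\<dots> = \<bar>c\<bar>^DIM('a) * (LINT x|lborel. f (t + c *\<^sub>R x))"
    by (simp add: integral_density integral_distr)
  finally show ?thesis .
qed

text \<open>The integrand factors over \<open>Basis\<close>, so the integral is a product of
  one-dimensional ones, each a multiple of a centred normal density of variance
  \<open>1 / (2 * c)\<close>. A translation then moves the centre to \<open>p\<close>.\<close>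

lemma integrable_gaussian_euclidean:
  fixes p :: "'a::euclidean_space"
  assumes "0 < c"
  shows "integrable lborel (\<lambda>y. exp (- c * (norm (y - p))\<^sup>2))"
proof -
  define s where "s = sqrt (1 / (2 * c))"
  have s: "0 < s" "2 * s\<^sup>2 = 1 / c"
    using assms by (auto simp: s_def)
  have eq: "exp (- c * u\<^sup>2) = sqrt (2 * pi * s\<^sup>2) * normal_density 0 s u" for u
    using s assms by (simp add: normal_density_def)
  have "integrable lborel (\<lambda>u::real. exp (- c * u\<^sup>2))"
    unfolding eq using integrable_normal_density[OF s(1)] by simp
  then have 1: "(\<integral>\<^sup>+u. ennreal (exp (- c * u\<^sup>2)) \<partial>lborel) < \<infinity>"
    unfolding real_integrable_def by (auto simp: less_top)
  have split: "exp (- c * (norm y)\<^sup>2) = (\<Prod>b\<in>Basis. exp (- c * (y \<bullet> b)\<^sup>2))" for y :: 'a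
    by (simp add: exp_sum[symmetric] sum_distrib_left[symmetric] power2_norm_eq_inner
        euclidean_inner[of y y] power2_eq_square[symmetric] sum_negf)
  have "(\<integral>\<^sup>+y. ennreal (exp (- c * (norm (y :: 'a))\<^sup>2)) \<partial>lborel)
      = (\<integral>\<^sup>+y. (\<Prod>b\<in>(Basis :: 'a set). ennreal (exp (- c * (y \<bullet> b)\<^sup>2))) \<partial>lborel)"
    by (subst split) (simp add: prod_ennreal)
  also have "\<dots> = (\<Prod>b\<in>(Basis::'a set). \<integral>\<^sup>+u. ennreal (exp (- c * u\<^sup>2)) \<partial>lborel)"
    by (subst nn_integral_lborel_prod) auto
  also have "\<dots> < \<infinity>"
    using 1 by (simp add: power_less_top_ennreal)
  finally have "integrable lborel (\<lambda>y::'a. exp (- c * (norm y)\<^sup>2))"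
    by (intro integrableI_bounded) auto
  from integrable_lborel_affine[of 1 _ "- p", OF _ this] show ?thesis
    by (simp add: norm_minus_commute)
qed

text \<open>If the integral vanished, \<open>w\<close> would be zero almost everywhere and
  \<open>U\<close> would be a null set, although it contains a ball of positive volume.\<close>

lemma integral_pos_if_pos_on_open:
  fixes w :: "'a::euclidean_space \<Rightarrow> real"
  assumes int: "integrable lborel w" and nn: "\<And>y. 0 \<le> w y"
    and U: "open U" "U \<noteq> {}" "\<And>y. y \<in> U \<Longrightarrow> 0 < w y"
  shows "0 < (LINT y|lborel. w y)"
proof (rule ccontr)
  assume "\<not> 0 < (LINT y|lborel. w y)"
  with Bochner_Integration.integral_nonneg[of lborel w] nn have "(LINT y|lborel. w y) = 0"
    by (simp add: not_less order_antisym)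
  then have "AE y in lborel. w y = 0"
    using integral_nonneg_eq_0_iff_AE[OF int] nn by simp
  then have "AE y in lborel. y \<notin> U"
    by eventually_elim (use U(3) in force)
  then have "U \<in> null_sets lborel"
    using U(1) by (simp add: AE_iff_null_sets)
  moreover obtain a e where "0 < e" "ball a e \<subseteq> U"
    using U by (metis all_not_in_conv open_contains_ball)
  ultimately have "ball a e \<in> null_sets lborel"
    by (auto intro: null_sets_subset)
  with content_ball_pos[OF \<open>0 < e\<close>, of a] show False
    by (simp add: measure_def null_sets_def)
qed

text \<open>
  Comparing the masses of \<open>w (p + z)\<close> and its dilation \<open>w (p + t *\<^sub>R z)\<close> replaces the integration by
  parts of the inner product of \<open>y - p\<close> with the gradient of \<open>w\<close>, so that no regularity of \<open>w\<close> and
  no control of boundary terms is required.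
\<close>
lemma second_moment_bound_by_dilation:
  fixes w :: "'a::euclidean_space \<Rightarrow> real"
  assumes int: "integrable lborel w" and nn: "\<And>y. 0 \<le> w y" and "0 < c"
    and dil: "\<And>t z. 0 < t \<Longrightarrow> t < 1 \<Longrightarrow>
      w (p + z) * (1 + c * (1 - t\<^sup>2) * (norm z)\<^sup>2) \<le> w (p + t *\<^sub>R z)"
  shows "integrable lborel (\<lambda>y. w y * (norm (y - p))\<^sup>2)"
    and "2 * c * (LINT y|lborel. w y * (norm (y - p))\<^sup>2) \<le> DIM('a) * (LINT y|lborel. w y)"
proof -
  have [measurable]: "w \<in> borel_measurable borel"
    using borel_measurable_integrable[OF int] by simp
  let ?m = "\<lambda>z. w (p + z) * (norm z)\<^sup>2"
  define M where "M = (LINT z|lborel. ?m z)"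
  define W where "W = (LINT y|lborel. w y)"
  have int1: "integrable lborel (\<lambda>z. w (p + z))"
    using integrable_lborel_affine[of 1, OF _ int, of p] by simp
  have W1: "(LINT z|lborel. w (p + z)) = W"
    using integral_lborel_affine[of 1 w p] by (simp add: W_def)
  have intt: "integrable lborel (\<lambda>z. w (p + t *\<^sub>R z))" if "0 < t" for t
    using integrable_lborel_affine[of t, OF _ int, of p] that by simp
  have dil': "(c * (1 - t\<^sup>2)) * ?m z \<le> w (p + t *\<^sub>R z) - w (p + z)" if "0 < t" "t < 1" for t z
    using dil[OF that, of z] by (simp add: algebra_simps)
  \<comment> \<open>Any fixed factor strictly between 0 and 1 would do: at \<open>t = 1/2\<close>,
    \<open>dil'\<close> dominates a positive multiple of \<open>?m\<close> by an integrable dilate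
    of \<open>w\<close>.\<close>
  have intm: "integrable lborel ?m"
  proof -
    have "integrable lborel (\<lambda>z. (c * (1 - (1/2)\<^sup>2)) * ?m z)"
    proof (rule Bochner_Integration.integrable_bound[OF intt[of "1/2"]])
      show "AE z in lborel. norm ((c * (1 - (1/2)\<^sup>2)) * ?m z) \<le> norm (w (p + (1/2) *\<^sub>R z))"
      proof (rule AE_I2)
        fix z
        show "norm ((c * (1 - (1/2)\<^sup>2)) * ?m z) \<le> norm (w (p + (1/2) *\<^sub>R z))"
          using dil'[of "1/2" z] nn[of "p + z"] nn[of "p + (1/2) *\<^sub>R z"] \<open>0 < c\<close>
          by (simp add: power_divide)
      qed
    qed (simp, measurable)
    moreover have "c * (1 - (1/2)\<^sup>2) \<noteq> 0"
      using \<open>0 < c\<close> by (simp add: power_divide)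
    ultimately show ?thesis
      using integrable_mult_left_iff[of lborel "c * (1 - (1/2)\<^sup>2)" ?m] by blast
  qed
  \<comment> \<open>By substitution the dilate has mass \<open>W / t ^ DIM('a)\<close>, so after
    scaling the gain is \<open>W * (1 - t ^ DIM('a))\<close>. Bernoulli's inequality bounds this by
    a multiple of \<open>1 - t\<close>, which cancels against the factor \<open>1 - t\<close> of
    \<open>1 - t\<^sup>2\<close>.\<close>
  have key: "c * (1 + t) * t ^ DIM('a) * M \<le> DIM('a) * W" if t: "0 < t" "t < 1" for t
  proof -
    have "(c * (1 - t\<^sup>2)) * M = (LINT z|lborel. (c * (1 - t\<^sup>2)) * ?m z)"
      unfolding M_def by simp
    also have "\<dots> \<le> (LINT z|lborel. w (p + t *\<^sub>R z) - w (p + z))"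
      using intm intt[OF t(1)] int1 dil'[OF t] by (intro integral_mono) auto
    also have "\<dots> = (LINT z|lborel. w (p + t *\<^sub>R z)) - W"
      using intt[OF t(1)] int1 W1 by simp
    finally have "t ^ DIM('a) * ((c * (1 - t\<^sup>2)) * M)
        \<le> t ^ DIM('a) * ((LINT z|lborel. w (p + t *\<^sub>R z)) - W)"
      using t by (intro mult_left_mono) auto
    also have "\<dots> = W * (1 - t ^ DIM('a))"
      using integral_lborel_affine[of t w p] t by (simp add: W_def algebra_simps)
    also have "\<dots> \<le> W * (DIM('a) * (1 - t))"
    proof (rule mult_left_mono)
      show "1 - t ^ DIM('a) \<le> DIM('a) * (1 - t)"
        using Bernoulli_inequality[of "t - 1" "DIM('a)"] t by (simp add: algebra_simps)
      show "0 \<le> W"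
        unfolding W_def using nn by simp
    qed
    finally have "(1 - t) * (c * (1 + t) * t ^ DIM('a) * M) \<le> (1 - t) * (DIM('a) * W)"
      by (simp add: algebra_simps power2_eq_square)
    then show ?thesis
      using t by simp
  qed
  \<comment> \<open>As \<open>t\<close> tends to 1, the remaining factor \<open>1 + t\<close>
    supplies the constant 2 of the conclusion, and the Jacobian \<open>t ^ DIM('a)\<close> tends to
    1.\<close>
  have "((\<lambda>t. c * (1 + t) * t ^ DIM('a) * M) \<longlongrightarrow> c * (1 + 1) * 1 ^ DIM('a) * M) (at_left 1)"
    by (intro tendsto_intros)
  moreover have "eventually (\<lambda>t::real. c * (1 + t) * t ^ DIM('a) * M \<le> DIM('a) * W) (at_left 1)"
    using eventually_at_left_real[of 0 1] key by (auto elim: eventually_mono)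
  ultimately have "c * (1 + 1) * 1 ^ DIM('a) * M \<le> DIM('a) * W"
    by (intro tendsto_upperbound) auto
  moreover have "M = (LINT y|lborel. w y * (norm (y - p))\<^sup>2)"
    using integral_lborel_affine[of 1 "\<lambda>y. w y * (norm (y - p))\<^sup>2" p] by (simp add: M_def)
  ultimately show "2 * c * (LINT y|lborel. w y * (norm (y - p))\<^sup>2) \<le> DIM('a) * (LINT y|lborel. w y)"
    by (simp add: W_def algebra_simps)
  show "integrable lborel (\<lambda>y. w y * (norm (y - p))\<^sup>2)"
    using integrable_lborel_affine[of 1, OF _ intm, of "- p"] by simp
qed

text \<open>Jensen's inequality for the squared norm under the normalized weight. It follows by
  integrating \<open>0 \<le> w y * (norm (y - p - v))\<^sup>2\<close>, where \<open>v\<close> is the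
  displacement of the barycentre from \<open>p\<close>.\<close>

lemma norm_barycenter_diff_sq_le:
  fixes w :: "'a::euclidean_space \<Rightarrow> real"
  assumes int: "integrable M w" and nn: "\<And>y. 0 \<le> w y" and pos: "0 < (LINT y|M. w y)"
    and meas: "(\<lambda>y. y) \<in> borel_measurable M"
    and int2: "integrable M (\<lambda>y. w y * (norm (y - p))\<^sup>2)"
  shows "(norm ((LINT y|M. w y *\<^sub>R y) /\<^sub>R (LINT y|M. w y) - p))\<^sup>2
    \<le> (LINT y|M. w y * (norm (y - p))\<^sup>2) / (LINT y|M. w y)"
proof -
  note [measurable] = meas borel_measurable_integrable[OF int]
  define W where "W = (LINT y|M. w y)"
  have intd: "integrable M (\<lambda>y. w y *\<^sub>R (y - p))"
  proof (rule Bochner_Integration.integrable_bound[OF Bochner_Integration.integrable_add[OF int int2]])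
    show "AE y in M. norm (w y *\<^sub>R (y - p)) \<le> norm (w y + w y * (norm (y - p))\<^sup>2)"
    proof (rule AE_I2)
      fix y
      \<comment> \<open>Bounding the first power by one plus the square makes the first moment
        integrable from the mass and the second moment.\<close>
      have "norm (y - p) \<le> 1 + (norm (y - p))\<^sup>2"
        using sum_squares_bound[of "norm (y - p)" 1] norm_ge_zero[of "y - p"]
        unfolding one_power2 mult_1_right by linarith
      then have "w y * norm (y - p) \<le> w y * (1 + (norm (y - p))\<^sup>2)"
        by (intro mult_left_mono nn)
      then show "norm (w y *\<^sub>R (y - p)) \<le> norm (w y + w y * (norm (y - p))\<^sup>2)"
        using nn[of y] by (simp add: distrib_left)
    qed
  qed measurable
  define v where "v = (LINT y|M. w y *\<^sub>R (y - p)) /\<^sub>R W"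
  have inty: "(LINT y|M. w y *\<^sub>R y) = (LINT y|M. w y *\<^sub>R (y - p)) + W *\<^sub>R p"
  proof -
    have "(LINT y|M. w y *\<^sub>R y) = (LINT y|M. w y *\<^sub>R (y - p) + w y *\<^sub>R p)"
      by (simp add: algebra_simps)
    also have "\<dots> = (LINT y|M. w y *\<^sub>R (y - p)) + W *\<^sub>R p"
      using intd int by (simp add: W_def)
    finally show ?thesis .
  qed
  have v: "(LINT y|M. w y *\<^sub>R y) /\<^sub>R W - p = v"
    using pos by (simp add: inty v_def W_def scaleR_add_right)
  \<comment> \<open>Written this way, the left side is the integral of an expression that lies
    pointwise below the second-moment integrand, by completing the square.\<close>
  have "W * (norm v)\<^sup>2 = 2 * ((LINT y|M. w y *\<^sub>R (y - p)) \<bullet> v) - W * (norm v)\<^sup>2"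
  proof -
    have "(LINT y|M. w y *\<^sub>R (y - p)) = W *\<^sub>R v"
      using pos by (simp add: v_def W_def)
    then show ?thesis by (simp add: power2_norm_eq_inner)
  qed
  also have "\<dots> = (LINT y|M. 2 * ((w y *\<^sub>R (y - p)) \<bullet> v) - w y * (norm v)\<^sup>2)"
    using intd int by (simp add: W_def del: inner_scaleR_left)
  also have "\<dots> \<le> (LINT y|M. w y * (norm (y - p))\<^sup>2)"
  proof (rule integral_mono)
    show "integrable M (\<lambda>y. 2 * ((w y *\<^sub>R (y - p)) \<bullet> v) - w y * (norm v)\<^sup>2)"
      using intd int by (simp del: inner_scaleR_left)
    fix y
    have "0 \<le> w y * (norm (y - p - v))\<^sup>2"
      using nn by simp
    also have "\<dots> = w y * (norm (y - p))\<^sup>2 - (2 * ((w y *\<^sub>R (y - p)) \<bullet> v) - w y * (norm v)\<^sup>2)"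
      by (simp add: power2_norm_eq_inner algebra_simps inner_commute)
    finally show "2 * ((w y *\<^sub>R (y - p)) \<bullet> v) - w y * (norm v)\<^sup>2 \<le> w y * (norm (y - p))\<^sup>2"
      by simp
  qed (rule int2)
  finally have "W * (norm v)\<^sup>2 \<le> (LINT y|M. w y * (norm (y - p))\<^sup>2)" .
  then show ?thesis
    using pos v by (simp add: W_def pos_le_divide_eq mult.commute)
qed

section \<open>Lower semicontinuity for extended-real functions\<close>

text \<open>The filter \<open>at x\<close> omits \<open>x\<close>, but \<open>x\<close> itself lies
  in the superlevel set, so a punctured neighbourhood can be completed to a full one. This form
  serves for sums, compactness and Borel measurability below.\<close>

lemma lower_semicontinuous_iff_open:
  "lower_semicontinuous f \<longleftrightarrow> (\<forall>c. open {y. c < f y})"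
proof
  assume lsc: "lower_semicontinuous f"
  show "\<forall>c. open {y. c < f y}"
  proof
    fix c
    show "open {y. c < f y}"
    proof (rule topological_space_class.openI)
      fix a assume a: "a \<in> {y. c < f y}"
      with lsc have "c < Liminf (at a) f"
        unfolding lower_semicontinuous_def by (auto intro: less_le_trans)
      then have "eventually (\<lambda>y. c < f y) (at a)"
        by (rule less_LiminfD)
      then obtain T where T: "open T" "a \<in> T" "\<And>y. y \<in> T \<Longrightarrow> y \<noteq> a \<Longrightarrow> c < f y"
        unfolding eventually_at_topological by auto
      have "T \<subseteq> {y. c < f y}"
        using a T(3) by auto
      with T(1,2) show "\<exists>T. open T \<and> a \<in> T \<and> T \<subseteq> {y. c < f y}"
        by (intro exI[of _ T] conjI)
    qed
  qed
next
  assume op: "\<forall>c. open {y. c < f y}"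
  show "lower_semicontinuous f"
    unfolding lower_semicontinuous_def le_Liminf_iff
  proof (intro allI impI)
    fix a c assume "c < f a"
    with op show "eventually (\<lambda>y. c < f y) (at a)"
      unfolding eventually_at_topological by (intro exI[of _ "{y. c < f y}"]) simp
  qed
qed

lemma lower_semicontinuous_add_continuous:
  fixes f :: "'a::topological_space \<Rightarrow> ereal"
  assumes ninf: "\<And>y. f y \<noteq> -\<infinity>" and lsc: "lower_semicontinuous f" and q: "continuous_on UNIV q"
  shows "lower_semicontinuous (\<lambda>y. f y + ereal (q y))"
  unfolding lower_semicontinuous_iff_open
proof
  fix c
  show "open {y. c < f y + ereal (q y)}"
  proof (cases c)
    case (real r)
    \<comment> \<open>A real level \<open>s\<close> separates the two summands, which presents the
      superlevel set as a union of intersections of open sets.\<close>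
    have "c < f y + ereal (q y) \<longleftrightarrow> (\<exists>s. ereal s < f y \<and> r - q y < s)" for y
    proof
      assume "c < f y + ereal (q y)"
      then have "ereal (r - q y) < f y"
        using real ninf[of y] by (cases "f y") auto
      then show "\<exists>s. ereal s < f y \<and> r - q y < s"
        by (metis ereal_dense2 less_ereal.simps(1))
    next
      assume "\<exists>s. ereal s < f y \<and> r - q y < s"
      then show "c < f y + ereal (q y)"
        using real ninf[of y] by (cases "f y") auto
    qed
    then have "{y. c < f y + ereal (q y)} = (\<Union>s. {y. ereal s < f y} \<inter> {y. r - q y < s})"
      by auto
    moreover have "open {y. r - q y < s}" for s
      using q by (intro open_Collect_less continuous_intros)
    ultimately show ?thesis
      using lsc by (auto simp: lower_semicontinuous_iff_open intro!: open_UN open_Int)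
  next
    case MInf
    then have "{y. c < f y + ereal (q y)} = UNIV"
      using ninf by (auto simp: less_le)
    then show ?thesis by simp
  qed auto
qed

text \<open>Without a minimizer, the open sets where \<open>f\<close> exceeds \<open>f b\<close>,
  for \<open>b\<close> in \<open>K\<close>, cover \<open>K\<close>. In a finite subcover, the index
  with the smallest value of \<open>f\<close> is itself left uncovered.\<close>

lemma lower_semicontinuous_attains_inf:
  fixes f :: "'a::topological_space \<Rightarrow> ereal"
  assumes lsc: "lower_semicontinuous f" and K: "compact K" "K \<noteq> {}"
  shows "\<exists>a\<in>K. \<forall>y\<in>K. f a \<le> f y"
proof (rule ccontr)
  assume "\<not> ?thesis"
  then have cov: "K \<subseteq> (\<Union>b\<in>K. {y. f b < f y})"
    by (auto simp: not_le)
  obtain B where B: "B \<subseteq> K" "finite B" "K \<subseteq> (\<Union>b\<in>B. {y. f b < f y})"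
    using compactE_image[OF K(1) _ cov] lsc by (metis lower_semicontinuous_iff_open)
  with K have "B \<noteq> {}" by auto
  then obtain a where "a \<in> B" "\<And>b. b \<in> B \<Longrightarrow> f a \<le> f b"
    using finite_ranking_induct by (metis B(2) arg_min_if_finite(1) arg_min_least)
  with B show False by force
qed

section \<open>Weak and strong convexity, growth at a minimizer, existence of minimizers\<close>

text \<open>The correction term comes from the identity \<open>sq\<close> for the squared norm of a
  convex combination. The modulus \<open>r\<close> may be negative; the inequality then expresses
  strong convexity with modulus \<open>- r\<close>.\<close>

lemma weakly_convexD:
  fixes g :: "'a::real_inner \<Rightarrow> ereal"
  assumes wc: "weakly_convex r g" and ab: "g a = ereal \<alpha>" "g b = ereal \<beta>"
    and uv: "0 \<le> u" "0 \<le> v" "u + v = 1"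
  shows "g (u *\<^sub>R a + v *\<^sub>R b) \<le> ereal (u * \<alpha> + v * \<beta> + r / 2 * u * v * (norm (a - b))\<^sup>2)"
proof -
  have "g (u *\<^sub>R a + v *\<^sub>R b) + ereal (r / 2 * (norm (u *\<^sub>R a + v *\<^sub>R b))\<^sup>2)
      \<le> ereal u * (g a + ereal (r / 2 * (norm a)\<^sup>2)) + ereal v * (g b + ereal (r / 2 * (norm b)\<^sup>2))"
    using wc uv unfolding weakly_convex_def convex_ereal_def by blast
  also have "\<dots> = ereal (u * (\<alpha> + r / 2 * (norm a)\<^sup>2) + v * (\<beta> + r / 2 * (norm b)\<^sup>2))"
    by (simp add: ab)
  finally have *: "g (u *\<^sub>R a + v *\<^sub>R b) \<le> ereal (u * (\<alpha> + r / 2 * (norm a)\<^sup>2)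
      + v * (\<beta> + r / 2 * (norm b)\<^sup>2) - r / 2 * (norm (u *\<^sub>R a + v *\<^sub>R b))\<^sup>2)"
    by (cases "g (u *\<^sub>R a + v *\<^sub>R b)") auto
  have sq: "(norm (u *\<^sub>R a + v *\<^sub>R b))\<^sup>2 = u * (norm a)\<^sup>2 + v * (norm b)\<^sup>2 - u * v * (norm (a - b))\<^sup>2"
  proof -
    have u: "u = 1 - v" using uv by simp
    show ?thesis
      unfolding u by (simp add: power2_norm_eq_inner inner_commute algebra_simps)
  qed
  have "u * (\<alpha> + r / 2 * (norm a)\<^sup>2) + v * (\<beta> + r / 2 * (norm b)\<^sup>2)
      - r / 2 * (norm (u *\<^sub>R a + v *\<^sub>R b))\<^sup>2
    = u * \<alpha> + v * \<beta> + r / 2 * u * v * (norm (a - b))\<^sup>2"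
    unfolding sq by (simp add: field_simps)
  with * show ?thesis
    by (simp only:)
qed

lemma weakly_convex_add_square_dist:
  fixes f :: "'a::real_inner \<Rightarrow> ereal"
  assumes ninf: "\<And>y. f y \<noteq> -\<infinity>" and wc: "weakly_convex r f"
  shows "weakly_convex (r - s) (\<lambda>y. f y + ereal (s / 2 * (norm (x - y))\<^sup>2))"
  unfolding weakly_convex_def convex_ereal_def
proof (intro allI impI)
  fix a b :: 'a and u v :: real
  assume uv: "0 \<le> u" "0 \<le> v" "u + v = 1"
  let ?h = "\<lambda>y. f y + ereal (s / 2 * (norm (x - y))\<^sup>2) + ereal ((r - s) / 2 * (norm y)\<^sup>2)"
  \<comment> \<open>What remains of the squared distance once its part quadratic in \<open>y\<close>
    is absorbed into the modulus; it is affine in \<open>y\<close>, so it preserves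
    convexity.\<close>
  define l where "l y = s / 2 * (norm x)\<^sup>2 - s * (x \<bullet> y)" for y
  have h: "?h y = (f y + ereal (r / 2 * (norm y)\<^sup>2)) + ereal (l y)" for y
    by (cases "f y") (simp_all add: l_def power2_norm_eq_inner inner_commute field_simps inner_diff_left inner_diff_right)
  have l: "l (u *\<^sub>R a + v *\<^sub>R b) = u * l a + v * l b"
  proof -
    have u: "u = 1 - v" using uv by simp
    show ?thesis unfolding u by (simp add: l_def inner_add_right inner_diff_right field_simps)
  qed
  have "?h (u *\<^sub>R a + v *\<^sub>R b)
      \<le> ereal u * (f a + ereal (r / 2 * (norm a)\<^sup>2)) + ereal v * (f b + ereal (r / 2 * (norm b)\<^sup>2))
        + ereal (u * l a + v * l b)"
    unfolding h l using wc uv unfolding weakly_convex_def convex_ereal_def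
    by (intro add_right_mono) blast
  also have "\<dots> = ereal u * ?h a + ereal v * ?h b"
  proof -
    \<comment> \<open>Distributivity fails in general for \<open>ereal\<close>; it holds here, even
      for infinite \<open>F\<close>, because the factor and the other summand are finite.\<close>
    have distrib: "ereal k * (F + ereal m) = ereal k * F + ereal (k * m)" if "0 \<le> k" for k m F
      using that by (cases F) (auto simp: distrib_left zero_ereal_def[symmetric])
    show ?thesis
      unfolding h distrib[OF uv(1)] distrib[OF uv(2)] plus_ereal.simps(1)[symmetric]
      by (simp only: add.assoc add.commute add.left_commute)
  qed
  finally show "?h (u *\<^sub>R a + v *\<^sub>R b) \<le> ereal u * ?h a + ereal v * ?h b" .
qed

text \<open>Minimality bounds \<open>g\<close> from below along the segment from \<open>p\<close> to
  \<open>y\<close> and strong convexity bounds it from above. Dividing by the weight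
  \<open>1 - t\<close> of \<open>y\<close> and letting \<open>t\<close> tend to 1 gives the full
  constant \<open>\<mu> / 2\<close>.\<close>

lemma strongly_convex_min_growth:
  fixes g :: "'a::real_inner \<Rightarrow> ereal"
  assumes wc: "weakly_convex (- \<mu>) g" and p: "g p = ereal \<gamma>" "\<And>y. g p \<le> g y"
  shows "ereal (\<gamma> + \<mu> / 2 * (norm (y - p))\<^sup>2) \<le> g y"
proof (cases "g y")
  case (real \<beta>)
  have le: "\<gamma> + \<mu> / 2 * t * (norm (y - p))\<^sup>2 \<le> \<beta>" if t: "0 < t" "t < 1" for t
  proof -
    have "ereal \<gamma> \<le> g (t *\<^sub>R p + (1 - t) *\<^sub>R y)"
      using p by metis
    also have "\<dots> \<le> ereal (t * \<gamma> + (1 - t) * \<beta> + - \<mu> / 2 * t * (1 - t) * (norm (p - y))\<^sup>2)"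
      using t by (intro weakly_convexD[OF wc p(1) real]) auto
    finally have "(1 - t) * (\<gamma> + \<mu> / 2 * t * (norm (y - p))\<^sup>2) \<le> (1 - t) * \<beta>"
      by (simp add: algebra_simps norm_minus_commute)
    then show ?thesis using t by simp
  qed
  have "((\<lambda>t. \<gamma> + \<mu> / 2 * t * (norm (y - p))\<^sup>2) \<longlongrightarrow> \<gamma> + \<mu> / 2 * 1 * (norm (y - p))\<^sup>2) (at_left 1)"
    by (intro tendsto_intros)
  moreover have "eventually (\<lambda>t::real. \<gamma> + \<mu> / 2 * t * (norm (y - p))\<^sup>2 \<le> \<beta>) (at_left 1)"
    using eventually_at_left_real[of 0 1] le by (auto elim: eventually_mono)
  ultimately have "\<gamma> + \<mu> / 2 * 1 * (norm (y - p))\<^sup>2 \<le> \<beta>"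
    by (intro tendsto_upperbound) auto
  then show ?thesis using real by simp
next
  case MInf
  then show ?thesis using p(1) p(2)[of y] by simp
qed simp

text \<open>Strong convexity on the segment from \<open>p\<close> to \<open>p + z\<close>
  contributes the factor \<open>t * (1 - t)\<close>, and quadratic growth at \<open>p\<close>,
  weighted by \<open>1 - t\<close>, contributes \<open>1 - t\<close>. Their sum is
  \<open>1 - t\<^sup>2\<close>.\<close>

lemma strongly_convex_dilation:
  fixes g :: "'a::real_inner \<Rightarrow> ereal"
  assumes wc: "weakly_convex (- \<mu>) g" and p: "g p = ereal \<gamma>" "\<And>y. g p \<le> g y"
    and t: "0 \<le> t" "t \<le> 1" and z: "g (p + z) = ereal \<beta>"
  shows "g (p + t *\<^sub>R z) \<le> ereal (\<beta> - \<mu> / 2 * (1 - t\<^sup>2) * (norm z)\<^sup>2)"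
proof -
  have "\<gamma> + \<mu> / 2 * (norm z)\<^sup>2 \<le> \<beta>"
    using strongly_convex_min_growth[OF wc p, of "p + z"] z by simp
  then have *: "(1 - t) * (\<gamma> + \<mu> / 2 * (norm z)\<^sup>2) \<le> (1 - t) * \<beta>"
    using t by (intro mult_left_mono) auto
  have "g (p + t *\<^sub>R z) = g ((1 - t) *\<^sub>R p + t *\<^sub>R (p + z))"
    by (simp add: algebra_simps)
  also have "\<dots> \<le> ereal ((1 - t) * \<gamma> + t * \<beta> + - \<mu> / 2 * (1 - t) * t * (norm (p - (p + z)))\<^sup>2)"
    using t by (intro weakly_convexD[OF wc p(1) z]) auto
  also have "(1 - t) * \<gamma> + t * \<beta> + - \<mu> / 2 * (1 - t) * t * (norm (p - (p + z)))\<^sup>2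
      = \<beta> - \<mu> / 2 * (1 - t\<^sup>2) * (norm z)\<^sup>2
        + ((1 - t) * (\<gamma> + \<mu> / 2 * (norm z)\<^sup>2) - (1 - t) * \<beta>)"
    by (simp add: field_simps power2_eq_square)
  also have "ereal \<dots> \<le> ereal (\<beta> - \<mu> / 2 * (1 - t\<^sup>2) * (norm z)\<^sup>2)"
    using * by simp
  finally show ?thesis .
qed

text \<open>Strong convexity gives coercivity: outside a large ball around a point \<open>a\<close>
  of finite value, \<open>g\<close> is at least \<open>g a\<close>, so a minimizer over that compact
  ball is global.\<close>

lemma strongly_convex_has_minimizer:
  fixes g :: "'a::euclidean_space \<Rightarrow> ereal"
  assumes wc: "weakly_convex (- \<mu>) g" and \<mu>: "0 < \<mu>" and lsc: "lower_semicontinuous g"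
    and ninf: "\<And>y. g y \<noteq> -\<infinity>" and proper: "proper_fun g"
  obtains p where "g p < \<infinity>" "\<And>y. g p \<le> g y"
proof -
  obtain a \<alpha> where a: "g a = ereal \<alpha>"
    using proper ninf unfolding proper_fun_def effective_domain_def
    by (metis (mono_tags, lifting) all_not_in_conv ereal_cases less_irrefl mem_Collect_eq)
  obtain b where b: "b \<in> cball a 1" "\<And>y. y \<in> cball a 1 \<Longrightarrow> g b \<le> g y"
    using lower_semicontinuous_attains_inf[OF lsc compact_cball, of a 1] by auto
  have "g b \<le> ereal \<alpha>" using b(2)[of a] a by simp
  then obtain m where m: "g b = ereal m" "m \<le> \<alpha>"
    using ninf[of b] by (cases "g b") auto
  \<comment> \<open>Chosen so that \<open>\<mu> / 2 * (R - 1) = \<alpha> - m\<close>.\<close>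
  define R where "R = 1 + 2 * (\<alpha> - m) / \<mu>"
  have R: "1 \<le> R" using m \<mu> by (simp add: R_def)
  text \<open>
    Far from \<open>a\<close>, the bound \<open>m\<close> on the unit sphere around \<open>a\<close> forces growth along each ray.
  \<close>
  have far: "ereal \<alpha> \<le> g y" if y: "y \<notin> cball a R" for y
  proof (cases "g y")
    case (real \<beta>)
    define r where "r = norm (y - a)"
    have r: "R < r" "1 < r" using y R by (auto simp: r_def dist_norm norm_minus_commute)
    have e: "(1 - 1 / r) *\<^sub>R a + (1 / r) *\<^sub>R y = a + (1 / r) *\<^sub>R (y - a)"
      by (simp add: algebra_simps)
    have "ereal m \<le> g ((1 - 1 / r) *\<^sub>R a + (1 / r) *\<^sub>R y)"
      unfolding m(1)[symmetric] e using r by (intro b(2)) (auto simp: dist_norm r_def)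
    also have "\<dots> \<le> ereal ((1 - 1 / r) * \<alpha> + 1 / r * \<beta> + - \<mu> / 2 * (1 - 1 / r) * (1 / r) * (norm (a - y))\<^sup>2)"
      using r by (intro weakly_convexD[OF wc a real]) auto
    finally have "m \<le> (1 - 1 / r) * \<alpha> + 1 / r * \<beta> + - \<mu> / 2 * (1 - 1 / r) * (1 / r) * r\<^sup>2"
      by (simp add: r_def norm_minus_commute)
    then have "r * m \<le> r * ((1 - 1 / r) * \<alpha> + 1 / r * \<beta> + - \<mu> / 2 * (1 - 1 / r) * (1 / r) * r\<^sup>2)"
      using r by (intro mult_left_mono) auto
    also have "\<dots> = (r - 1) * \<alpha> + \<beta> - r * (\<mu> / 2 * (r - 1))"
      using r by (simp add: field_simps power2_eq_square)
    finally have 1: "r * (\<mu> / 2 * (r - 1) - (\<alpha> - m)) \<le> \<beta> - \<alpha>"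
      by (simp add: algebra_simps)
    have "\<alpha> - m = \<mu> / 2 * (R - 1)" using \<mu> by (simp add: R_def)
    also have "\<dots> \<le> \<mu> / 2 * (r - 1)" using r \<mu> by (intro mult_left_mono) auto
    finally have "0 \<le> r * (\<mu> / 2 * (r - 1) - (\<alpha> - m))" using r by simp
    with 1 real show ?thesis by simp
  qed (use ninf in auto)
  obtain p where p: "p \<in> cball a R" "\<And>y. y \<in> cball a R \<Longrightarrow> g p \<le> g y"
    using lower_semicontinuous_attains_inf[OF lsc compact_cball, of a R] R by auto
  have pa: "g p \<le> ereal \<alpha>" using p(2)[of a] R a by simp
  show thesis
  proof
    show "g p < \<infinity>" using pa by (auto simp: less_top[symmetric])
    show "g p \<le> g y" for y using p(2) far pa order_trans by blast
  qed
qed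

section \<open>The Gaussian expectation as a Lebesgue integral\<close>

lemma exp_ereal_nonneg: "0 \<le> exp_ereal a"
  by (simp add: exp_ereal_def)

lemma prod_normal_density_eq:
  fixes x y :: "real ^ 'n"
  assumes "0 < s"
  shows "(\<Prod>i\<in>UNIV. normal_density (x $ i) (sqrt s) (y $ i))
    = (1 / sqrt (2 * pi * s)) ^ CARD('n) * exp (- (norm (x - y))\<^sup>2 / (2 * s))"
proof -
  have "(norm (x - y))\<^sup>2 = (\<Sum>i\<in>UNIV. (y $ i - x $ i)\<^sup>2)"
    by (simp add: norm_vec_def L2_set_def sum_nonneg power2_commute)
  then show ?thesis
    using assms by (simp add: normal_density_def prod_dividef prod.distrib exp_sum[symmetric]
        sum_divide_distrib[symmetric] sum_negf power_divide)
qed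

text \<open>The Gaussian exponent merges with \<open>f\<close> into the proximal objective, and the
  normalizing constant \<open>k\<close> cancels in the quotient. Where \<open>f\<close> is infinite,
  both weights are zero by the convention in \<open>exp_ereal\<close>.\<close>

lemma gibbs_mean_eq_lborel:
  fixes f :: "real ^ 'n \<Rightarrow> ereal" and x :: "real ^ 'n"
  assumes ninf: "\<And>y. f y \<noteq> -\<infinity>" and [measurable]: "f \<in> borel_measurable borel"
    and pos: "0 < lam" "0 < \<delta>"
  defines "w \<equiv> \<lambda>y. exp_ereal (- (f y + ereal (1 / (2 * lam) * (norm (x - y))\<^sup>2)) / ereal \<delta>)"
  shows "gibbs_mean lam f \<delta> x = (LINT y|lborel. w y *\<^sub>R y) /\<^sub>R (LINT y|lborel. w y)"
proof -
  define k where "k = (1 / sqrt (2 * pi * (\<delta> * lam))) ^ CARD('n)"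
  have k: "0 < k" using pos by (simp add: k_def)
  let ?e = "\<lambda>y. exp_ereal (- f y / ereal \<delta>)"
  let ?G = "\<lambda>y. \<Prod>i\<in>UNIV. normal_density (x $ i) (sqrt (\<delta> * lam)) (y $ i)"
  have e: "?e \<in> borel_measurable borel"
    unfolding exp_ereal_def by measurable
  have G: "?G \<in> borel_measurable borel"
    unfolding normal_density_def by measurable
  have G0: "0 \<le> ?G y" for y by (intro prod_nonneg) simp
  have kw: "?G y * ?e y = k * w y" for y
  proof -
    have "?e y * exp (- (norm (x - y))\<^sup>2 / (2 * (\<delta> * lam))) = w y"
      using ninf[of y] pos unfolding w_def exp_ereal_def
      by (cases "f y") (auto simp: exp_add[symmetric] field_simps)
    moreover have "?G y = k * exp (- (norm (x - y))\<^sup>2 / (2 * (\<delta> * lam)))"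
      unfolding k_def using pos by (intro prod_normal_density_eq) simp
    ultimately show ?thesis by (simp add: mult_ac)
  qed
  have 1: "(LINT y|isotropic_gaussian x (\<delta> * lam). ?e y) = k * (LINT y|lborel. w y)"
  proof -
    have "(LINT y|isotropic_gaussian x (\<delta> * lam). ?e y) = (LINT y|lborel. ?G y *\<^sub>R ?e y)"
      unfolding isotropic_gaussian_def using e G G0 by (intro integral_density) auto
    also have "\<dots> = (LINT y|lborel. k * w y)"
      by (simp only: real_scaleR_def kw)
    finally show ?thesis by simp
  qed
  have 2: "(LINT y|isotropic_gaussian x (\<delta> * lam). ?e y *\<^sub>R y) = k *\<^sub>R (LINT y|lborel. w y *\<^sub>R y)"
  proof -
    have "(LINT y|isotropic_gaussian x (\<delta> * lam). ?e y *\<^sub>R y) = (LINT y|lborel. ?G y *\<^sub>R (?e y *\<^sub>R y))"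
      unfolding isotropic_gaussian_def using e G G0
      by (intro integral_density borel_measurable_scaleR) auto
    also have "\<dots> = (LINT y|lborel. k *\<^sub>R (w y *\<^sub>R y))"
      by (simp only: scaleR_scaleR kw)
    finally show ?thesis by (simp only: integral_scaleR_right)
  qed
  show ?thesis
    unfolding gibbs_mean_def 1 2 using k by simp
qed

section \<open>Application to the proximal objective and its Gibbs weight\<close>

theorem theorem3p1:
  fixes f :: "real ^ 'n \<Rightarrow> ereal" and \<rho> lam \<mu> :: real and x :: "real ^ 'n"
  assumes "\<And>y. f y \<noteq> -\<infinity>"
    and "proper_fun f"
    and "lower_semicontinuous f"
    and "0 \<le> \<rho>"
    and "weakly_convex \<rho> f"
    and "interior (effective_domain f) \<noteq> {}"
    and "0 < lam" and "ereal lam < 1 / ereal \<rho>"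
    and "\<mu> = 1 / lam - \<rho>"
  shows "\<forall>\<delta>>0. norm (gibbs_mean lam f \<delta> x - prox lam f x) \<le> sqrt (real CARD('n) * \<delta> / \<mu>)"
proof (intro allI impI)
  fix \<delta> :: real assume \<delta>: "0 < \<delta>"
  have \<mu>: "0 < \<mu>"
  \<comment> \<open>The case split is due to \<open>1 / ereal 0\<close> being infinite; for
    \<open>\<rho> = 0\<close>, \<open>\<mu>\<close> is just \<open>1 / lam\<close>.\<close>
  proof (cases "\<rho> = 0")
    case False
    then have "lam < 1 / \<rho>" using assms(4,8) by (simp add: divide_ereal_def inverse_eq_divide)
    then have "\<rho> < 1 / lam" using False assms(4,7) by (simp add: field_simps)
    then show ?thesis using assms(9) by simp
  qed (use assms(7,9) in simp)
  define g where "g y = f y + ereal (1 / (2 * lam) * (norm (x - y))\<^sup>2)" for y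
  have ninf: "g y \<noteq> -\<infinity>" for y
    using assms(1)[of y] by (cases "f y") (auto simp: g_def)
  have fin: "g y < \<infinity> \<longleftrightarrow> f y < \<infinity>" for y
    by (cases "f y") (auto simp: g_def)
  \<comment> \<open>The quadratic term lowers the modulus from \<open>\<rho>\<close> to
    \<open>\<rho> - 1 / lam\<close>, which is \<open>- \<mu>\<close>.\<close>
  have wc: "weakly_convex (- \<mu>) g"
    using weakly_convex_add_square_dist[OF assms(1,5), of "1 / lam" x]
    by (simp add: assms(9) g_def[abs_def] mult.commute)
  have lsc: "lower_semicontinuous g"
    unfolding g_def[abs_def]
    by (intro lower_semicontinuous_add_continuous assms(1,3) continuous_intros)
  have "proper_fun g"
    using assms(2) unfolding proper_fun_def effective_domain_def fin .
  then obtain p where p: "g p < \<infinity>" "\<And>y. g p \<le> g y"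
    using strongly_convex_has_minimizer[OF wc \<mu> lsc ninf] by blast
  obtain \<gamma> where \<gamma>: "g p = ereal \<gamma>"
    using p(1) ninf[of p] by (cases "g p") auto
  note growth = strongly_convex_min_growth[OF wc \<gamma> p(2)]
  have prox: "prox lam f x = p"
    unfolding prox_def g_def[symmetric]
  proof (rule the_equality)
    show "is_arg_min g (\<lambda>_. True) p"
      using p(2) by (simp add: is_arg_min_linorder)
    fix q assume "is_arg_min g (\<lambda>_. True) q"
    then have "g q \<le> ereal \<gamma>" using \<gamma> by (metis is_arg_min_linorder)
    with growth[of q] have "ereal (\<gamma> + \<mu> / 2 * (norm (q - p))\<^sup>2) \<le> ereal \<gamma>"
      by (rule order_trans)
    \<comment> \<open>Quadratic growth at \<open>p\<close> forces uniqueness, so the definite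
      description in \<open>prox_def\<close> denotes \<open>p\<close>.\<close>
    then have "norm (q - p) = 0" using \<mu> by (simp add: mult_le_0_iff)
    then show "q = p" by simp
  qed
  define w where "w y = exp_ereal (- g y / ereal \<delta>)" for y
  \<comment> \<open>Dividing the growth constant \<open>\<mu> / 2\<close> by the temperature
    \<open>\<delta>\<close>; the factor \<open>2 * c = \<mu> / \<delta>\<close> of the moment bound
    then produces \<open>\<delta> / \<mu>\<close> in the result.\<close>
  define c where "c = \<mu> / (2 * \<delta>)"
  have c: "0 < c" using \<mu> \<delta> by (simp add: c_def)
  have w_real: "w y = exp (- \<beta> / \<delta>)" if "g y = ereal \<beta>" for y \<beta>
    using that \<delta> by (simp add: w_def exp_ereal_def)
  have w_inf: "w y = 0" if "g y = \<infinity>" for y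
    using that \<delta> by (simp add: w_def exp_ereal_def)
  have w0: "0 \<le> w y" for y by (simp add: w_def exp_ereal_nonneg)
  have meas: "h \<in> borel_measurable borel" if "lower_semicontinuous h" for h :: "real ^ 'n \<Rightarrow> ereal"
    using that by (intro borel_measurableI_greater) (simp add: lower_semicontinuous_iff_open)
  have [measurable]: "g \<in> borel_measurable borel" by (rule meas[OF lsc])
  have [measurable]: "w \<in> borel_measurable borel"
    unfolding w_def[abs_def] exp_ereal_def by measurable
  \<comment> \<open>Quadratic growth of \<open>g\<close> turns into Gaussian decay of
    \<open>w\<close>, which yields integrability.\<close>
  have w_le: "w y \<le> exp (- \<gamma> / \<delta>) * exp (- c * (norm (y - p))\<^sup>2)" for y
  proof (cases "g y")
    case (real \<beta>)
    with growth[of y] have "\<gamma> + \<mu> / 2 * (norm (y - p))\<^sup>2 \<le> \<beta>" by simp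
    then have "- \<beta> / \<delta> \<le> - (\<gamma> + \<mu> / 2 * (norm (y - p))\<^sup>2) / \<delta>"
      using \<delta> by (intro divide_right_mono) auto
    also have "\<dots> = - \<gamma> / \<delta> + - c * (norm (y - p))\<^sup>2"
      using \<delta> by (simp add: c_def field_simps)
    finally show ?thesis by (simp add: w_real[OF real] exp_add[symmetric])
  qed (use ninf w_inf in auto)
  have int: "integrable lborel w"
  proof (rule Bochner_Integration.integrable_bound)
    show "integrable lborel (\<lambda>y. exp (- \<gamma> / \<delta>) * exp (- c * (norm (y - p))\<^sup>2))"
      by (intro integrable_mult_right integrable_gaussian_euclidean c)
    show "AE y in lborel. norm (w y) \<le> norm (exp (- \<gamma> / \<delta>) * exp (- c * (norm (y - p))\<^sup>2))"
      using w_le w0 by (intro AE_I2) (simp add: abs_mult)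
  qed simp
  \<comment> \<open>The interior of the effective domain keeps the denominator of the Gibbs mean
    from vanishing.\<close>
  have pos: "0 < (LINT y|lborel. w y)"
  proof (rule integral_pos_if_pos_on_open[OF int w0 open_interior assms(6)])
    fix y assume "y \<in> interior (effective_domain f)"
    then have "y \<in> effective_domain f"
      using interior_subset by blast
    then have "g y < \<infinity>"
      unfolding effective_domain_def fin by simp
    then show "0 < w y" using ninf[of y] w_real by (cases "g y") auto
  qed
  have dil: "w (p + z) * (1 + c * (1 - t\<^sup>2) * (norm z)\<^sup>2) \<le> w (p + t *\<^sub>R z)"
    if t: "0 < t" "t < 1" for t z
  proof (cases "g (p + z)")
    case (real \<beta>)
    have le: "g (p + t *\<^sub>R z) \<le> ereal (\<beta> - \<mu> / 2 * (1 - t\<^sup>2) * (norm z)\<^sup>2)"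
      using t by (intro strongly_convex_dilation[OF wc \<gamma> p(2) _ _ real]) auto
    then obtain \<beta>' where \<beta>': "g (p + t *\<^sub>R z) = ereal \<beta>'"
      using ninf[of "p + t *\<^sub>R z"] by (cases "g (p + t *\<^sub>R z)") auto
    \<comment> \<open>The inequality \<open>1 + u \<le> exp u\<close> turns the additive decrease of
      \<open>g\<close> under dilation into the linear gain required by the moment bound.\<close>
    have "w (p + z) * (1 + c * (1 - t\<^sup>2) * (norm z)\<^sup>2)
        \<le> exp (- \<beta> / \<delta>) * exp (c * (1 - t\<^sup>2) * (norm z)\<^sup>2)"
      unfolding w_real[OF real] by (intro mult_left_mono exp_ge_add_one_self) auto
    also have "\<dots> = exp (- (\<beta> - \<mu> / 2 * (1 - t\<^sup>2) * (norm z)\<^sup>2) / \<delta>)"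
      using \<delta> by (simp add: exp_add[symmetric] c_def field_simps)
    also have "\<dots> \<le> exp (- \<beta>' / \<delta>)"
    proof -
      have "- (\<beta> - \<mu> / 2 * (1 - t\<^sup>2) * (norm z)\<^sup>2) \<le> - \<beta>'"
        using le \<beta>' by simp
      then show ?thesis
        unfolding exp_le_cancel_iff using \<delta> by (intro divide_right_mono) auto
    qed
    finally show ?thesis by (simp add: w_real[OF \<beta>'])
  qed (use ninf w_inf w0 in auto)
  note moment = second_moment_bound_by_dilation[OF int w0 c dil]
  let ?I = "LINT y|lborel. w y * (norm (y - p))\<^sup>2" and ?W = "LINT y|lborel. w y"
  have "gibbs_mean lam f \<delta> x = (LINT y|lborel. w y *\<^sub>R y) /\<^sub>R ?W"
    using gibbs_mean_eq_lborel[OF assms(1) meas[OF assms(3)] assms(7) \<delta>]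
    by (simp add: w_def[abs_def] g_def)
  then have "(norm (gibbs_mean lam f \<delta> x - p))\<^sup>2 \<le> ?I / ?W"
    using norm_barycenter_diff_sq_le[OF int w0 pos _ moment(1)] by simp
  also have "\<dots> \<le> real CARD('n) * \<delta> / \<mu>"
    using moment(2) pos \<delta> \<mu> by (simp add: c_def field_simps)
  finally show "norm (gibbs_mean lam f \<delta> x - prox lam f x) \<le> sqrt (real CARD('n) * \<delta> / \<mu>)"
    unfolding prox by (rule real_le_rsqrt)
qed

end
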